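(* Let $\Delta$ be of type $C_n$ and let $\mathfrak{Ab}$ be its poset of abelian ideals. Then $\mathcal K^{u}_{\mathfrak{Ab}}(q)=\mathcal K^{l}_{\mathfrak{Ab}}(q)=\sum_{k\ge0}\binom{n+1}{2k}q^k$.
   Context: Type $C_n$: positive roots $\Delta^+=\{\varepsilon_i\pm\varepsilon_j\ (1\le i<j\le n),\ 2\varepsilon_i\ (1\le i\le n)\}$, simple roots $\varepsilon_i-\varepsilon_{i+1}$ ($i<n$), $2\varepsilon_n$, with the root order (generated by $\gamma$ covering $\mu$ iff $\gamma-\mu$ is a simple root). An upper ideal $I\subset\Delta^+$ (up-closed subset) is abelian if $\gamma'+\gamma''\notin\Delta^+$ for all $\gamma',\gamma''\in I$; $\mathfrak{Ab}$ is the poset of all abelian upper ideals (including $\varnothing$) ordered by inclusion. For a finite poset, $\kappa(x)$ (resp. $\iota(x)$) is the number of elements covered by (resp. covering) $x$; $\mathcal K^{u}=\sum_x q^{\kappa(x)}$, $\mathcal K^{l}=\sum_x q^{\iota(x)}$. *)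

theory Defs
  imports "HOL-Library.Function_Algebras" "HOL-Computational_Algebra.Polynomial"
begin

text \<open>
  All roots of type \<open>C\<^sub>n\<close> lie in the lattice spanned by \<open>\<epsilon>\<^sub>1, \<dots>, \<epsilon>\<^sub>n\<close>, so a root is represented
  by its coordinate function, which vanishes outside \<open>{1..n}\<close>. Addition and subtraction are
  pointwise.
\<close>

type_synonym vec = "nat \<Rightarrow> int"

definition eps :: "nat \<Rightarrow> vec" where
  "eps i = (\<lambda>k. if k = i then 1 else 0)"

definition pos_roots_C :: "nat \<Rightarrow> vec set" where
  "pos_roots_C n =
     {eps i - eps j | i j. 1 \<le> i \<and> i < j \<and> j \<le> n} \<union>
     {eps i + eps j | i j. 1 \<le> i \<and> i < j \<and> j \<le> n} \<union>
     {eps i + eps i | i. 1 \<le> i \<and> i \<le> n}"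

definition simple_roots_C :: "nat \<Rightarrow> vec set" where
  "simple_roots_C n = {eps i - eps (i + 1) | i. 1 \<le> i \<and> i < n} \<union> {eps n + eps n}"

definition root_cover_C :: "nat \<Rightarrow> (vec \<times> vec) set" where
  "root_cover_C n =
     {(\<mu>, \<gamma>). \<mu> \<in> pos_roots_C n \<and> \<gamma> \<in> pos_roots_C n \<and> \<gamma> - \<mu> \<in> simple_roots_C n}"

definition root_le_C :: "nat \<Rightarrow> vec \<Rightarrow> vec \<Rightarrow> bool" where
  "root_le_C n \<mu> \<gamma> \<longleftrightarrow> (\<mu>, \<gamma>) \<in> (root_cover_C n)\<^sup>*"

definition upper_ideal_C :: "nat \<Rightarrow> vec set \<Rightarrow> bool" where
  "upper_ideal_C n I \<longleftrightarrow>
     I \<subseteq> pos_roots_C n \<and>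
     (\<forall>\<mu>\<in>I. \<forall>\<gamma>\<in>pos_roots_C n. root_le_C n \<mu> \<gamma> \<longrightarrow> \<gamma> \<in> I)"

definition abelian_C :: "nat \<Rightarrow> vec set \<Rightarrow> bool" where
  "abelian_C n I \<longleftrightarrow> (\<forall>\<gamma>'\<in>I. \<forall>\<gamma>''\<in>I. \<gamma>' + \<gamma>'' \<notin> pos_roots_C n)"

definition abelian_ideals_C :: "nat \<Rightarrow> vec set set" where
  "abelian_ideals_C n = {I. upper_ideal_C n I \<and> abelian_C n I}"

text \<open>
  A finite poset is a finite subset \<open>P\<close> of an ordered type, with the induced order; for families
  of sets, this is inclusion. The relation \<open>covers P x y\<close> says that \<open>x\<close> covers \<open>y\<close> in \<open>P\<close>.
\<close>

definition covers :: "'a::order set \<Rightarrow> 'a \<Rightarrow> 'a \<Rightarrow> bool" where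
  "covers P x y \<longleftrightarrow> x \<in> P \<and> y \<in> P \<and> y < x \<and> \<not> (\<exists>z\<in>P. y < z \<and> z < x)"

definition kappa :: "'a::order set \<Rightarrow> 'a \<Rightarrow> nat" where
  "kappa P x = card {y \<in> P. covers P x y}"

definition iota :: "'a::order set \<Rightarrow> 'a \<Rightarrow> nat" where
  "iota P x = card {y \<in> P. covers P y x}"

text \<open>The polynomials \<open>\<K>\<^sup>u\<close> and \<open>\<K>\<^sup>l\<close> in the indeterminate \<open>q\<close>; \<open>monom c k\<close> is \<open>c q\<^sup>k\<close>.\<close>

definition K_upper :: "'a::order set \<Rightarrow> int poly" where
  "K_upper P = (\<Sum>x\<in>P. monom 1 (kappa P x))"

definition K_lower :: "'a::order set \<Rightarrow> int poly" where
  "K_lower P = (\<Sum>x\<in>P. monom 1 (iota P x))"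

end

theory Submission
  imports Defs "HOL-Library.FuncSet"
begin

text \<open>
  Two roots of the form \<open>\<epsilon>\<^sub>i + \<epsilon>\<^sub>j\<close> never add up to a root, while an upper ideal containing
  \<open>\<epsilon>\<^sub>i - \<epsilon>\<^sub>j\<close> also contains \<open>\<epsilon>\<^sub>i - \<epsilon>\<^sub>n\<close> and \<open>\<epsilon>\<^sub>i + \<epsilon>\<^sub>n\<close>, whose sum is
  the root \<open>2\<epsilon>\<^sub>i\<close>. So the abelian ideals are the upper ideals of the staircase of roots
  \<open>\<epsilon>\<^sub>i + \<epsilon>\<^sub>j\<close>. Such an ideal meets the diagonal \<open>j - i = m\<close> in an initial segment, say of
  length \<open>f m\<close>, and the functions \<open>f\<close> that arise are the lattice paths with
  \<open>f m - f (m + 1) \<in> {0, 1}\<close> and \<open>f n = 0\<close>. In terms of the set \<open>S \<subseteq> {0..<n}\<close> of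
  descents of \<open>f\<close>, the number of elements covered by \<open>f\<close> is the number of maximal runs of
  \<open>S\<close>, and the number of elements covering \<open>f\<close> is that of the complement of \<open>S\<close>.
  The numbers of sets with a given number of runs satisfy Pascal's recurrence.
\<close>

section \<open>Invariance under order isomorphism\<close>

lemma covers_iso:
  assumes h: "bij_betw h A B" and le: "\<And>x y. x \<in> A \<Longrightarrow> y \<in> A \<Longrightarrow> h x \<le> h y \<longleftrightarrow> x \<le> y"
    and "x \<in> A" "y \<in> A"
  shows "covers B (h x) (h y) \<longleftrightarrow> covers A x y"
proof -
  have B: "B = h ` A" using h by (simp add: bij_betw_def)
  have lt: "h x < h y \<longleftrightarrow> x < y" if "x \<in> A" "y \<in> A" for x y
    using le that by (simp add: less_le_not_le)
  show ?thesis using assms(3,4) lt unfolding covers_def B by auto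
qed

lemma kappa_iso:
  assumes h: "bij_betw h A B" and le: "\<And>x y. x \<in> A \<Longrightarrow> y \<in> A \<Longrightarrow> h x \<le> h y \<longleftrightarrow> x \<le> y"
    and x: "x \<in> A"
  shows "kappa B (h x) = kappa A x"
proof -
  have B: "B = h ` A" and inj: "inj_on h A" using h by (simp_all add: bij_betw_def)
  have "{y \<in> B. covers B (h x) y} = h ` {y \<in> A. covers A x y}"
    using covers_iso[OF h le x] B by auto
  moreover have "inj_on h {y \<in> A. covers A x y}" using inj by (rule inj_on_subset) auto
  ultimately show ?thesis by (simp add: kappa_def card_image)
qed

lemma iota_iso:
  assumes h: "bij_betw h A B" and le: "\<And>x y. x \<in> A \<Longrightarrow> y \<in> A \<Longrightarrow> h x \<le> h y \<longleftrightarrow> x \<le> y"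
    and x: "x \<in> A"
  shows "iota B (h x) = iota A x"
proof -
  have B: "B = h ` A" and inj: "inj_on h A" using h by (simp_all add: bij_betw_def)
  have "{y \<in> B. covers B y (h x)} = h ` {y \<in> A. covers A y x}"
    using covers_iso[OF h le _ x] B by auto
  moreover have "inj_on h {y \<in> A. covers A y x}" using inj by (rule inj_on_subset) auto
  ultimately show ?thesis by (simp add: iota_def card_image)
qed

lemma K_upper_iso:
  assumes "bij_betw h A B" and "\<And>x y. x \<in> A \<Longrightarrow> y \<in> A \<Longrightarrow> h x \<le> h y \<longleftrightarrow> x \<le> y"
  shows "K_upper B = K_upper A"
  unfolding K_upper_def
  by (subst sum.reindex_bij_betw[OF assms(1), symmetric]) (simp add: kappa_iso[OF assms])

lemma K_lower_iso:
  assumes "bij_betw h A B" and "\<And>x y. x \<in> A \<Longrightarrow> y \<in> A \<Longrightarrow> h x \<le> h y \<longleftrightarrow> x \<le> y"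
  shows "K_lower B = K_lower A"
  unfolding K_lower_def
  by (subst sum.reindex_bij_betw[OF assms(1), symmetric]) (simp add: iota_iso[OF assms])

section \<open>Lattice paths\<close>

definition lattice_paths :: "nat \<Rightarrow> (nat \<Rightarrow> nat) set" where
  "lattice_paths n =
     {f. (\<forall>m\<ge>n. f m = 0) \<and> (\<forall>m. f (Suc m) \<le> f m \<and> f m \<le> Suc (f (Suc m)))}"

lemma lattice_pathsD:
  assumes "f \<in> lattice_paths n"
  shows "m \<ge> n \<Longrightarrow> f m = 0" "f (Suc m) \<le> f m" "f m \<le> Suc (f (Suc m))"
  using assms by (auto simp: lattice_paths_def)

lemma lattice_paths_bound:
  assumes "f \<in> lattice_paths n"
  shows "f m \<le> n - m"
proof (cases "m \<le> n")
  case True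
  then show ?thesis
  proof (induction m rule: inc_induct)
    case (step m)
    then show ?case using lattice_pathsD(3)[OF assms, of m] by simp
  qed (simp add: lattice_pathsD(1)[OF assms])
qed (simp add: lattice_pathsD(1)[OF assms])

section \<open>Covers in the poset of lattice paths\<close>

definition peaks :: "nat \<Rightarrow> (nat \<Rightarrow> nat) \<Rightarrow> nat set" where
  "peaks n f = {m. m < n \<and> f m = Suc (f (Suc m)) \<and> (m = 0 \<or> f (m - 1) = f m)}"

definition valleys :: "nat \<Rightarrow> (nat \<Rightarrow> nat) \<Rightarrow> nat set" where
  "valleys n f = {m. m < n \<and> f m = f (Suc m) \<and> (m = 0 \<or> f (m - 1) = Suc (f m))}"

text \<open>Lowering one value affects only the two step inequalities that link \<open>m\<close> to
  its neighbours, and 0 has no left neighbour. Positivity matters: at \<open>f m = 0\<close>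
  truncated subtraction would leave \<open>f\<close> unchanged.\<close>

lemma decrement_in_lattice_paths_iff:
  assumes f: "f \<in> lattice_paths n" and pos: "0 < f m"
  shows "f(m := f m - 1) \<in> lattice_paths n \<longleftrightarrow> m \<in> peaks n f"
proof
  assume g: "f(m := f m - 1) \<in> lattice_paths n"
  have "m < n" using lattice_pathsD(1)[OF f, of m] pos by (metis not_less less_irrefl)
  moreover have "f m = Suc (f (Suc m))"
    using lattice_pathsD(3)[OF f, of m] lattice_pathsD(2)[OF g, of m] pos by simp
  moreover have "f (m - 1) = f m" if "m \<noteq> 0"
    using lattice_pathsD(2)[OF f, of "m - 1"] lattice_pathsD(3)[OF g, of "m - 1"] pos that
    by (simp split: if_splits)
  ultimately show "m \<in> peaks n f" by (auto simp: peaks_def)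
next
  assume m: "m \<in> peaks n f"
  have "(f(m := f m - 1)) (Suc k) \<le> (f(m := f m - 1)) k \<and>
        (f(m := f m - 1)) k \<le> Suc ((f(m := f m - 1)) (Suc k))" for k
    using lattice_pathsD(2,3)[OF f, of k] m by (auto simp: peaks_def)
  then show "f(m := f m - 1) \<in> lattice_paths n"
    using lattice_pathsD(1)[OF f] by (auto simp: lattice_paths_def)
qed

lemma increment_in_lattice_paths_iff:
  assumes f: "f \<in> lattice_paths n"
  shows "f(m := Suc (f m)) \<in> lattice_paths n \<longleftrightarrow> m \<in> valleys n f"
proof
  assume g: "f(m := Suc (f m)) \<in> lattice_paths n"
  have "m < n" using lattice_pathsD(1)[OF g, of m] by (metis fun_upd_same not_less nat.distinct(1))
  moreover have "f m = f (Suc m)"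
    using lattice_pathsD(2)[OF f, of m] lattice_pathsD(3)[OF g, of m] by simp
  moreover have "f (m - 1) = Suc (f m)" if "m \<noteq> 0"
    using lattice_pathsD(3)[OF f, of "m - 1"] lattice_pathsD(2)[OF g, of "m - 1"] that
    by (simp split: if_splits)
  ultimately show "m \<in> valleys n f" by (auto simp: valleys_def)
next
  assume m: "m \<in> valleys n f"
  have "(f(m := Suc (f m))) (Suc k) \<le> (f(m := Suc (f m))) k \<and>
        (f(m := Suc (f m))) k \<le> Suc ((f(m := Suc (f m))) (Suc k))" for k
    using lattice_pathsD(2,3)[OF f, of k] m by (auto simp: valleys_def)
  moreover have "(f(m := Suc (f m))) k = 0" if "k \<ge> n" for k
    using lattice_pathsD(1)[OF f that] m that by (auto simp: valleys_def)
  ultimately show "f(m := Suc (f m)) \<in> lattice_paths n"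
    unfolding lattice_paths_def by blast
qed

text \<open>Lowering \<open>f\<close> at the peak found here gives a path that still lies above
  \<open>g\<close>; hence a path covered by \<open>f\<close> differs from it by a single
  unit.\<close>

lemma peak_between:
  assumes f: "f \<in> lattice_paths n" and g: "g \<in> lattice_paths n" and "g < f"
  obtains m where "m \<in> peaks n f" "g m < f m"
proof -
  have le: "g k \<le> f k" for k using \<open>g < f\<close> by (simp add: less_fun_def le_fun_def)
  let ?M = "{m. g m < f m}"
  have sub: "?M \<subseteq> {..<n}"
  proof
    fix m assume "m \<in> ?M"
    then show "m \<in> {..<n}" using lattice_pathsD(1)[OF f, of m] by (cases "m < n") auto
  qed
  then have fin: "finite ?M" using finite_subset by blast
  have ne: "?M \<noteq> {}" using \<open>g < f\<close> by (auto simp: less_fun_def le_fun_def not_le)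
  \<comment> \<open>Diagonal \<open>m\<close> of the ideal of \<open>f\<close> ends in \<open>\<epsilon>\<^sub>i + \<epsilon>\<^sub>j\<close> with \<open>i + j = 2 * f m + m\<close>;
    the largest index sum belongs to a minimal root of the difference of the ideals.\<close>
  have "Max ((\<lambda>k. 2 * f k + k) ` ?M) \<in> (\<lambda>k. 2 * f k + k) ` ?M"
    by (intro Max_in finite_imageI fin) (use ne in blast)
  then obtain m where "m \<in> ?M" and Max: "2 * f m + m = Max ((\<lambda>k. 2 * f k + k) ` ?M)"
    by (metis (no_types, lifting) imageE)
  then have m: "g m < f m" by simp
  have max: "f k = g k" if "2 * f k + k > 2 * f m + m" for k
  proof (rule ccontr)
    assume "f k \<noteq> g k"
    then have "k \<in> ?M" using le[of k] by simp
    then have "2 * f k + k \<le> 2 * f m + m" unfolding Max using fin by (intro Max_ge) auto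
    then show False using that by simp
  qed
  have "m < n" using sub m by auto
  \<comment> \<open>If \<open>f (Suc m) = f m\<close>, the weight \<open>2 * f k + k\<close> grows
    by 1 at \<open>Suc m\<close>, so \<open>f\<close> and \<open>g\<close> agree there and
    \<open>f m = g (Suc m) \<le> g m\<close>, a contradiction. If
    \<open>f (m - 1) = Suc (f m)\<close>, it grows by 1 at \<open>m - 1\<close>, and again
    \<open>f m \<le> g m\<close>.\<close>
  moreover have "f m = Suc (f (Suc m))"
    using max[of "Suc m"] m lattice_pathsD(2)[OF g, of m] lattice_pathsD(2,3)[OF f, of m] by force
  moreover have "f (m - 1) = f m" if "m \<noteq> 0"
    using max[of "m - 1"] m lattice_pathsD(3)[OF g, of "m - 1"]
      lattice_pathsD(2,3)[OF f, of "m - 1"] that by force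
  ultimately have "m \<in> peaks n f" unfolding peaks_def by blast
  then show ?thesis using that m by blast
qed

lemma covers_lattice_paths_iff:
  assumes f: "f \<in> lattice_paths n" and g: "g \<in> lattice_paths n"
  shows "covers (lattice_paths n) f g \<longleftrightarrow> (\<exists>m. f = g(m := Suc (g m)))"
proof
  assume c: "covers (lattice_paths n) f g"
  then have "g < f" by (simp add: covers_def)
  obtain m where m: "m \<in> peaks n f" "g m < f m" using peak_between[OF f g \<open>g < f\<close>] .
  let ?h = "f(m := f m - 1)"
  have "?h \<in> lattice_paths n"
    using decrement_in_lattice_paths_iff[OF f, of m] m by auto
  moreover have "?h < f" using m(2) by (auto simp: less_fun_def le_fun_def intro!: exI[of _ m])
  moreover have "g \<le> ?h" using m(2) \<open>g < f\<close> by (auto simp: less_fun_def le_fun_def)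
  ultimately have "g = ?h" using c by (auto simp: covers_def less_le)
  then have "f = g(m := Suc (g m))" using m(2) by auto
  then show "\<exists>m. f = g(m := Suc (g m))" ..
next
  assume "\<exists>m. f = g(m := Suc (g m))"
  then obtain m where fm: "f = g(m := Suc (g m))" ..
  have "g < f" by (auto simp: fm less_fun_def le_fun_def intro!: exI[of _ m])
  moreover have False if "g < z" "z < f" for z
  proof -
    have gz: "g k \<le> z k" and zf: "z k \<le> f k" for k
      using that by (auto simp: less_fun_def le_fun_def)
    have "z k = g k" if "k \<noteq> m" for k using gz[of k] zf[of k] that by (simp add: fm)
    then have "z = g(m := z m)" by auto
    moreover have "z m = g m \<or> z m = Suc (g m)" using gz[of m] zf[of m] by (auto simp: fm)
    ultimately have "z = g \<or> z = f" by (metis fm fun_upd_triv)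
    then show False using that by auto
  qed
  ultimately show "covers (lattice_paths n) f g" using f g by (auto simp: covers_def)
qed

lemma kappa_lattice_paths:
  assumes f: "f \<in> lattice_paths n"
  shows "kappa (lattice_paths n) f = card (peaks n f)"
proof -
  have "{g \<in> lattice_paths n. covers (lattice_paths n) f g} = (\<lambda>m. f(m := f m - 1)) ` peaks n f"
    (is "?L = ?R")
  proof
    show "?L \<subseteq> ?R"
    proof
      fix g assume "g \<in> ?L"
      then obtain m where g: "g \<in> lattice_paths n" and fm: "f = g(m := Suc (g m))"
        using covers_lattice_paths_iff[OF f] by auto
      have eq: "g = f(m := f m - 1)" by (simp add: fm)
      moreover have "m \<in> peaks n f" using decrement_in_lattice_paths_iff[OF f, of m] g eq fm
        by (metis fun_upd_same zero_less_Suc)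
      ultimately show "g \<in> ?R" by blast
    qed
    show "?R \<subseteq> ?L"
    proof
      fix g assume "g \<in> ?R"
      then obtain m where m: "m \<in> peaks n f" and g: "g = f(m := f m - 1)" by auto
      have pos: "0 < f m" using m by (simp add: peaks_def)
      have gP: "g \<in> lattice_paths n" using decrement_in_lattice_paths_iff[OF f pos] m g by simp
      have "f = g(m := Suc (g m))" using pos by (simp add: g)
      then show "g \<in> ?L" using covers_lattice_paths_iff[OF f gP] gP by blast
    qed
  qed
  moreover have "inj_on (\<lambda>m. f(m := f m - 1)) (peaks n f)"
  proof (rule inj_onI)
    fix k m assume "k \<in> peaks n f" and eq: "f(k := f k - 1) = f(m := f m - 1)"
    then have "f k > 0" by (simp add: peaks_def)
    then show "k = m" using fun_cong[OF eq, of k] by (auto split: if_splits)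
  qed
  ultimately show ?thesis by (simp add: kappa_def card_image)
qed

lemma iota_lattice_paths:
  assumes f: "f \<in> lattice_paths n"
  shows "iota (lattice_paths n) f = card (valleys n f)"
proof -
  have "{g \<in> lattice_paths n. covers (lattice_paths n) g f} = (\<lambda>m. f(m := Suc (f m))) ` valleys n f"
    using covers_lattice_paths_iff[OF _ f] increment_in_lattice_paths_iff[OF f] by auto
  moreover have "inj_on (\<lambda>m. f(m := Suc (f m))) (valleys n f)"
  proof (rule inj_onI)
    fix k m assume eq: "f(k := Suc (f k)) = f(m := Suc (f m))"
    show "k = m" using fun_cong[OF eq, of k] by (auto split: if_splits)
  qed
  ultimately show ?thesis by (simp add: iota_def card_image)
qed

section \<open>Counting sets by runs\<close>

text \<open>Every maximal run of consecutive integers has one least element, so the cardinality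
  counts the runs. The case \<open>m = 0\<close> is separate because \<open>0 - 1 = 0\<close> for
  naturals.\<close>

definition run_starts :: "nat set \<Rightarrow> nat set" where
  "run_starts S = {m \<in> S. m = 0 \<or> m - 1 \<notin> S}"

text \<open>\<open>S\<close> serves as the descent set: a path that ends at 0 and drops by one at
  each descent has at \<open>m\<close> a height equal to the number of descents from
  \<open>m\<close> on.\<close>

definition path_of :: "nat set \<Rightarrow> nat \<Rightarrow> nat" where
  "path_of S m = card (S \<inter> {m..})"

lemma path_of_step:
  assumes "finite S"
  shows "path_of S m = path_of S (Suc m) + (if m \<in> S then 1 else 0)"
proof -
  have "S \<inter> {m..} = (if m \<in> S then insert m (S \<inter> {Suc m..}) else S \<inter> {Suc m..})"
    by (auto simp: Suc_le_eq le_less)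
  then show ?thesis using assms by (simp add: path_of_def)
qed

text \<open>The inverse collects the descents of a path. A step that is not constant drops by
  exactly 1, so backward induction from the value 0 at \<open>n\<close> recovers the path.\<close>

lemma bij_betw_path_of: "bij_betw path_of (Pow {..<n}) (lattice_paths n)"
proof (rule bij_betwI[where g = "\<lambda>f. {m. f m \<noteq> f (Suc m)}"])
  have fin: "finite S" if "S \<in> Pow {..<n}" for S using that finite_subset[of S "{..<n}"] by auto
  show "path_of \<in> Pow {..<n} \<rightarrow> lattice_paths n"
  proof
    fix S assume S: "S \<in> Pow {..<n}"
    have "path_of S m = 0" if "m \<ge> n" for m
    proof -
      have "S \<inter> {m..} = {}" using S that by auto
      then show ?thesis by (simp add: path_of_def)
    qed
    moreover have "path_of S (Suc m) \<le> path_of S m \<and> path_of S m \<le> Suc (path_of S (Suc m))" for m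
      using path_of_step[OF fin[OF S], of m] by simp
    ultimately show "path_of S \<in> lattice_paths n" by (simp add: lattice_paths_def)
  qed
  show "(\<lambda>f. {m. f m \<noteq> f (Suc m)}) \<in> lattice_paths n \<rightarrow> Pow {..<n}"
  proof
    fix f assume f: "f \<in> lattice_paths n"
    have "m < n" if "f m \<noteq> f (Suc m)" for m
      using that lattice_pathsD(1)[OF f, of m] lattice_pathsD(1)[OF f, of "Suc m"] by linarith
    then show "{m. f m \<noteq> f (Suc m)} \<in> Pow {..<n}" by auto
  qed
  show "{m. path_of S m \<noteq> path_of S (Suc m)} = S" if "S \<in> Pow {..<n}" for S
  proof -
    have "path_of S m \<noteq> path_of S (Suc m) \<longleftrightarrow> m \<in> S" for m
      using path_of_step[OF fin[OF that], of m] by simp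
    then show ?thesis by simp
  qed
  show "path_of {m. f m \<noteq> f (Suc m)} = f" if f: "f \<in> lattice_paths n" for f
  proof
    let ?S = "{m. f m \<noteq> f (Suc m)}"
    have sub: "?S \<subseteq> {..<n}"
      using \<open>(\<lambda>f. {m. f m \<noteq> f (Suc m)}) \<in> lattice_paths n \<rightarrow> Pow {..<n}\<close> f by blast
    then have "?S \<in> Pow {..<n}" by auto
    note S = sub fin[OF this]
    show "path_of ?S m = f m" for m
    proof (cases "m \<le> n")
      case True
      then show ?thesis
      proof (induction m rule: inc_induct)
        case base
        have "?S \<inter> {n..} = {}" using S(1) by fastforce
        then show ?case using lattice_pathsD(1)[OF f, of n] by (simp add: path_of_def)
      next
        case (step m)
        then show ?case
          using path_of_step[OF S(2), of m] lattice_pathsD(2,3)[OF f, of m] by auto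
      qed
    next
      case False
      then have "?S \<inter> {m..} = {}" using S(1) by fastforce
      then show ?thesis using lattice_pathsD(1)[OF f, of m] False by (simp add: path_of_def)
    qed
  qed
qed

text \<open>A peak has a descent at \<open>m\<close> and none at \<open>m - 1\<close>, so it is an
  element of \<open>S\<close> without predecessor in \<open>S\<close>. For valleys, \<open>S\<close>
  and its complement swap roles.\<close>

lemma peaks_path_of:
  assumes "S \<subseteq> {..<n}"
  shows "peaks n (path_of S) = run_starts S"
proof -
  have "finite S" using assms finite_subset by auto
  then have "path_of S m = Suc (path_of S (Suc m)) \<longleftrightarrow> m \<in> S"
    and "m \<noteq> 0 \<Longrightarrow> path_of S (m - 1) = path_of S m \<longleftrightarrow> m - 1 \<notin> S" for m
    using path_of_step[of S m] path_of_step[of S "m - 1"] by auto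
  then show ?thesis using assms unfolding peaks_def run_starts_def by blast
qed

lemma valleys_path_of:
  assumes "S \<subseteq> {..<n}"
  shows "valleys n (path_of S) = run_starts ({..<n} - S)"
proof -
  have "finite S" using assms finite_subset by auto
  then have "path_of S m = path_of S (Suc m) \<longleftrightarrow> m \<notin> S"
    and "m \<noteq> 0 \<Longrightarrow> path_of S (m - 1) = Suc (path_of S m) \<longleftrightarrow> m - 1 \<in> S" for m
    using path_of_step[of S m] path_of_step[of S "m - 1"] by auto
  then show ?thesis unfolding valleys_def run_starts_def by auto
qed

section \<open>Pascal recurrence for the number of runs\<close>

definition run_poly :: "nat \<Rightarrow> int poly" where
  "run_poly n = (\<Sum>S\<in>Pow {..<n}. monom 1 (card (run_starts S)))"

text \<open>Subsets of \<open>{..n}\<close> that contain \<open>n\<close> get their own polynomial,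
  since whether \<open>Suc n\<close> opens a new run depends on the presence of
  \<open>n\<close>.\<close>

definition run_poly_last :: "nat \<Rightarrow> int poly" where
  "run_poly_last n = (\<Sum>S\<in>Pow {..<n}. monom 1 (card (run_starts (insert n S))))"

lemma K_upper_lattice_paths: "K_upper (lattice_paths n) = run_poly n"
proof -
  have "kappa (lattice_paths n) (path_of S) = card (run_starts S)" if "S \<in> Pow {..<n}" for S
    using that bij_betwE[OF bij_betw_path_of] by (simp add: kappa_lattice_paths peaks_path_of)
  then show ?thesis
    unfolding K_upper_def run_poly_def
    by (subst sum.reindex_bij_betw[OF bij_betw_path_of, symmetric]) simp
qed

lemma K_lower_lattice_paths: "K_lower (lattice_paths n) = run_poly n"
proof -
  have "iota (lattice_paths n) (path_of S) = card (run_starts ({..<n} - S))"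
    if "S \<in> Pow {..<n}" for S
    using that bij_betwE[OF bij_betw_path_of] by (simp add: iota_lattice_paths valleys_path_of)
  then have "K_lower (lattice_paths n) = (\<Sum>S\<in>Pow {..<n}. monom 1 (card (run_starts ({..<n} - S))))"
    unfolding K_lower_def
    by (subst sum.reindex_bij_betw[OF bij_betw_path_of, symmetric]) simp
  \<comment> \<open>Complementation in \<open>{..<n}\<close> is an involution of the index set; this
    is the source of the equality of the upper and lower polynomials.\<close>
  also have "\<dots> = run_poly n"
    unfolding run_poly_def
    by (rule sum.reindex_bij_witness[where i = "\<lambda>S. {..<n} - S" and j = "\<lambda>S. {..<n} - S"])
      (auto simp: double_diff)
  finally show ?thesis .
qed

lemma sum_Pow_lessThan_Suc:
  fixes F :: "nat set \<Rightarrow> 'a::comm_monoid_add"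
  shows "(\<Sum>S\<in>Pow {..<Suc n}. F S) = (\<Sum>S\<in>Pow {..<n}. F S) + (\<Sum>S\<in>Pow {..<n}. F (insert n S))"
proof -
  have "inj_on (insert n) (Pow {..<n})"
    by (rule inj_onI) (metis Diff_insert_absorb PowD lessThan_iff less_irrefl subsetD)
  then show ?thesis
    by (subst lessThan_Suc, subst Pow_insert, subst sum.union_disjoint)
      (auto simp: sum.reindex)
qed

lemma run_starts_insert:
  assumes "S \<subseteq> {..<n}"
  shows "card (run_starts (insert n S)) =
    card (run_starts S) + (if n = 0 \<or> n - 1 \<notin> S then 1 else 0)"
proof -
  have "finite (run_starts S)"
    using assms by (auto simp: run_starts_def intro: finite_subset[of _ "{..<n}"])
  moreover have "n \<notin> run_starts S" using assms by (auto simp: run_starts_def)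
  moreover have "run_starts (insert n S) =
      (if n = 0 \<or> n - 1 \<notin> S then insert n (run_starts S) else run_starts S)"
    using assms by (auto simp: run_starts_def)
  ultimately show ?thesis by simp
qed

lemma run_poly_Suc: "run_poly (Suc n) = run_poly n + run_poly_last n"
  by (simp add: run_poly_def run_poly_last_def sum_Pow_lessThan_Suc)

text \<open>If \<open>n\<close> is absent, \<open>Suc n\<close> is a run of its own and contributes
  a factor q; if \<open>n\<close> is present, \<open>Suc n\<close> only prolongs the last
  run.\<close>

lemma run_poly_last_Suc: "run_poly_last (Suc n) = monom 1 1 * run_poly n + run_poly_last n"
proof -
  have "card (run_starts (insert (Suc n) S)) = Suc (card (run_starts S))"
    "card (run_starts (insert (Suc n) (insert n S))) = card (run_starts (insert n S))"
    if "S \<in> Pow {..<n}" for S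
    using that run_starts_insert[of S "Suc n"] run_starts_insert[of "insert n S" "Suc n"]
    by force+
  then show ?thesis
    by (simp add: run_poly_def run_poly_last_def sum_Pow_lessThan_Suc sum_distrib_left mult_monom)
qed

text \<open>A subset of \<open>{..<n}\<close> with \<open>k\<close> runs amounts to
  \<open>2 * k\<close> run boundaries among the \<open>n + 1\<close> cut points. If \<open>n\<close>
  is adjoined, the last boundary is forced and \<open>2 * k - 1\<close> remain to be chosen. The two
  recurrences are Pascal's rule for even and odd lower index, so both claims go through one
  induction.\<close>

lemma coeff_run_poly:
  "coeff (run_poly n) k = int (Suc n choose (2 * k)) \<and>
   coeff (run_poly_last n) k = (case k of 0 \<Rightarrow> 0 | Suc j \<Rightarrow> int (Suc n choose (2 * j + 1)))"
proof (induction n arbitrary: k)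
  case 0
  have "run_starts {} = {}" "run_starts {0} = {0}" by (auto simp: run_starts_def)
  then show ?case
    by (auto simp: run_poly_def run_poly_last_def binomial_eq_0 split: nat.split)
next
  case (Suc n)
  show ?case
  proof (cases k)
    case 0
    with Suc[of 0] show ?thesis
      by (simp add: run_poly_Suc run_poly_last_Suc coeff_monom_mult)
  next
    case k: (Suc j)
    with Suc[of k] Suc[of j] show ?thesis
      by (simp add: run_poly_Suc run_poly_last_Suc coeff_monom_mult)
  qed
qed

text \<open>Cutting the sum off at \<open>n + 1\<close> loses nothing, because the binomial
  coefficient vanishes once \<open>2 * k > n + 1\<close>.\<close>

lemma run_poly_eq: "run_poly n = (\<Sum>k\<le>n+1. monom (int ((n + 1) choose (2 * k))) k)"
proof (rule poly_eqI)
  fix k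
  have "coeff (\<Sum>k\<le>n+1. monom (int ((n + 1) choose (2 * k))) k) k =
      (if k \<le> n + 1 then int ((n + 1) choose (2 * k)) else 0)"
    by (simp add: coeff_sum del: sum.atMost_Suc binomial_Suc_Suc)
  also have "\<dots> = int ((n + 1) choose (2 * k))"
  proof (cases "k \<le> n + 1")
    case False
    then have "n + 1 < 2 * k" by simp
    then show ?thesis using False by (simp only: binomial_eq_0) simp
  qed simp
  finally show "coeff (run_poly n) k =
      coeff (\<Sum>k\<le>n+1. monom (int ((n + 1) choose (2 * k))) k) k"
    by (simp add: coeff_run_poly)
qed

section \<open>Abelian ideals as lattice paths\<close>

text \<open>Induction along a chain of covers lets closure be tested one simple root at a
  time.\<close>

lemma upper_ideal_C_iff:
  "upper_ideal_C n I \<longleftrightarrow>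
     I \<subseteq> pos_roots_C n \<and> (\<forall>(\<mu>, \<gamma>)\<in>root_cover_C n. \<mu> \<in> I \<longrightarrow> \<gamma> \<in> I)"
proof
  assume "upper_ideal_C n I"
  then show "I \<subseteq> pos_roots_C n \<and> (\<forall>(\<mu>, \<gamma>)\<in>root_cover_C n. \<mu> \<in> I \<longrightarrow> \<gamma> \<in> I)"
    unfolding upper_ideal_C_def root_le_C_def root_cover_C_def by blast
next
  assume *: "I \<subseteq> pos_roots_C n \<and> (\<forall>(\<mu>, \<gamma>)\<in>root_cover_C n. \<mu> \<in> I \<longrightarrow> \<gamma> \<in> I)"
  have "\<gamma> \<in> I" if "(\<mu>, \<gamma>) \<in> (root_cover_C n)\<^sup>*" "\<mu> \<in> I" for \<mu> \<gamma>
    using that by (induction rule: rtrancl_induct) (use * in auto)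
  then show "upper_ideal_C n I" using * by (auto simp: upper_ideal_C_def root_le_C_def)
qed

section \<open>Roots, coordinate sums and covers\<close>

lemma eps_add_eps_eq_iff:
  "eps a + eps b = eps c + eps d \<longleftrightarrow> a = c \<and> b = d \<or> a = d \<and> b = c"
proof
  assume eq: "eps a + eps b = eps c + eps d"
  show "a = c \<and> b = d \<or> a = d \<and> b = c"
    using fun_cong[OF eq, of a] fun_cong[OF eq, of b] fun_cong[OF eq, of c] fun_cong[OF eq, of d]
    by (auto simp: eps_def split: if_splits)
qed (auto simp: add.commute)

lemma sum_coords_eps:
  assumes "i \<le> n"
  shows "(\<Sum>x\<le>n. eps i x) = 1"
  using assms by (simp add: eps_def)

lemma pos_roots_C_cases:
  assumes "v \<in> pos_roots_C n"
  obtains (diff) i j where "v = eps i - eps j" "1 \<le> i" "i < j" "j \<le> n"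
  | (sum) i j where "v = eps i + eps j" "1 \<le> i" "i \<le> j" "j \<le> n"
  using assms unfolding pos_roots_C_def
  by (elim UnE CollectE exE conjE) (blast intro: less_imp_le le_refl)+

text \<open>The coordinate sum is 0 on differences and 2 on roots \<open>eps i + eps j\<close>.
  Being additive, it shows that two roots of the second kind never add up to a root.\<close>

lemma sum_coords_pos_root: "v \<in> pos_roots_C n \<Longrightarrow> (\<Sum>x\<le>n. v x) \<le> 2"
  by (cases v n rule: pos_roots_C_cases) (auto simp: sum.distrib sum_subtractf sum_coords_eps)

lemma eps_add_in_pos_roots_C: "1 \<le> i \<Longrightarrow> i \<le> j \<Longrightarrow> j \<le> n \<Longrightarrow> eps i + eps j \<in> pos_roots_C n"
  unfolding pos_roots_C_def by (cases "i = j") (blast intro: le_neq_implies_less)+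

lemma eps_diff_in_pos_roots_C: "1 \<le> i \<Longrightarrow> i < j \<Longrightarrow> j \<le> n \<Longrightarrow> eps i - eps j \<in> pos_roots_C n"
  unfolding pos_roots_C_def by auto

text \<open>The bound 2 on the coordinate sum excludes the simple root \<open>eps n + eps n\<close>.
  Adding \<open>eps k - eps (k + 1)\<close> keeps the sum 2, so the new root is no difference and
  has no negative coordinate; the -1 at \<open>Suc k\<close> must therefore be cancelled by
  \<open>i\<close> or \<open>j\<close>.\<close>

lemma root_cover_C_eps_addE:
  assumes "(eps i + eps j, \<gamma>) \<in> root_cover_C n" "i \<le> n" "j \<le> n"
  obtains k where "1 \<le> k" "\<gamma> = eps k + eps j" "i = Suc k"
  | k where "1 \<le> k" "\<gamma> = eps i + eps k" "j = Suc k"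
proof -
  have \<gamma>: "\<gamma> \<in> pos_roots_C n" and s: "\<gamma> - (eps i + eps j) \<in> simple_roots_C n"
    using assms(1) by (auto simp: root_cover_C_def)
  have tot: "(\<Sum>x\<le>n. \<gamma> x) \<le> 2"
    using \<gamma> by (rule sum_coords_pos_root)
  have tot': "(\<Sum>x\<le>n. (\<gamma> - (eps i + eps j)) x) = (\<Sum>x\<le>n. \<gamma> x) - 2"
    using assms(2,3) by (simp add: sum.distrib sum_subtractf sum_coords_eps)
  have "\<gamma> - (eps i + eps j) \<noteq> eps n + eps n"
  proof
    assume "\<gamma> - (eps i + eps j) = eps n + eps n"
    then have "(\<Sum>x\<le>n. (\<gamma> - (eps i + eps j)) x) = 2"
      by (simp only: plus_fun_apply sum.distrib sum_coords_eps order.refl)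
    then show False using tot tot' by simp
  qed
  then obtain k where k: "1 \<le> k" "k < n" and eq: "\<gamma> - (eps i + eps j) = eps k - eps (k + 1)"
    using s by (auto simp: simple_roots_C_def)
  have tot2: "(\<Sum>x\<le>n. \<gamma> x) = 2"
    using tot' k by (simp add: eq sum_subtractf sum_coords_eps)
  obtain a b where ab: "\<gamma> = eps a + eps b"
    using \<gamma>
  proof (cases rule: pos_roots_C_cases)
    case (diff a b)
    then have "(\<Sum>x\<le>n. \<gamma> x) = 0" by (simp add: sum_subtractf sum_coords_eps)
    then show ?thesis using tot2 by simp
  qed
  have \<gamma>_eq: "\<gamma> = eps i + eps j + eps k - eps (Suc k)" using eq by (simp add: algebra_simps)
  have "i = Suc k \<or> j = Suc k"
    using fun_cong[OF \<gamma>_eq, of "Suc k"] by (auto simp: ab eps_def split: if_splits)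
  then show ?thesis
    using that k(1) \<gamma>_eq by (auto simp: algebra_simps)
qed

section \<open>From lattice paths to abelian ideals\<close>

definition ideal_of :: "(nat \<Rightarrow> nat) \<Rightarrow> vec set" where
  "ideal_of f = {eps i + eps (i + m) | i m. 1 \<le> i \<and> i \<le> f m}"

text \<open>Writing the indices as \<open>i\<close> and \<open>i + m\<close> fixes their order, so
  each root comes from exactly one pair \<open>(i, m)\<close>.\<close>

lemma eps_add_in_ideal_of_iff: "eps i + eps (i + m) \<in> ideal_of f \<longleftrightarrow> 1 \<le> i \<and> i \<le> f m"
  by (auto simp: ideal_of_def eps_add_eps_eq_iff)

text \<open>The last root on diagonal \<open>m\<close>, at \<open>i = f m\<close>, tests
  \<open>f m \<le> g m\<close>. Antisymmetry later turns this into injectivity.\<close>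

lemma ideal_of_le_iff: "ideal_of f \<le> ideal_of g \<longleftrightarrow> f \<le> g"
proof
  assume le: "ideal_of f \<le> ideal_of g"
  have "f m \<le> g m" for m
  proof (cases "f m = 0")
    case False
    then have "eps (f m) + eps (f m + m) \<in> ideal_of f" by (simp add: eps_add_in_ideal_of_iff)
    then have "eps (f m) + eps (f m + m) \<in> ideal_of g" using le by blast
    then show ?thesis by (simp add: eps_add_in_ideal_of_iff)
  qed simp
  then show "f \<le> g" by (simp add: le_fun_def)
next
  assume "f \<le> g"
  then show "ideal_of f \<le> ideal_of g"
    unfolding ideal_of_def le_fun_def using le_trans by blast
qed

text \<open>Lowering the first index leads to diagonal \<open>Suc m\<close> and uses
  \<open>f m \<le> Suc (f (Suc m))\<close>; lowering the second leads to the previous diagonal and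
  uses monotonicity. Commutativity is excluded from no pair: two members add up to coordinate sum 4,
  too large for a root.\<close>

lemma ideal_of_in_abelian_ideals_C:
  assumes f: "f \<in> lattice_paths n"
  shows "ideal_of f \<in> abelian_ideals_C n"
proof -
  have bound: "i + m \<le> n" if "1 \<le> i" "i \<le> f m" for i m
    using lattice_paths_bound[OF f, of m] that by linarith
  have sub: "ideal_of f \<subseteq> pos_roots_C n"
    using bound by (auto simp: ideal_of_def intro!: eps_add_in_pos_roots_C)
  have "\<gamma> \<in> ideal_of f" if c: "(\<mu>, \<gamma>) \<in> root_cover_C n" and "\<mu> \<in> ideal_of f" for \<mu> \<gamma>
  proof -
    obtain i m where \<mu>: "\<mu> = eps i + eps (i + m)" and im: "1 \<le> i" "i \<le> f m"
      using \<open>\<mu> \<in> ideal_of f\<close> by (auto simp: ideal_of_def)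
    have le: "i \<le> n" "i + m \<le> n" using bound[OF im] by auto
    show ?thesis
    proof (rule root_cover_C_eps_addE[OF c[unfolded \<mu>] le])
      fix k assume k: "1 \<le> k" "\<gamma> = eps k + eps (i + m)" "i = Suc k"
      then have "\<gamma> = eps k + eps (k + Suc m)" by simp
      moreover have "k \<le> f (Suc m)" using lattice_pathsD(3)[OF f, of m] im k by simp
      ultimately show ?thesis using k by (simp only: eps_add_in_ideal_of_iff)
    next
      fix k assume k: "1 \<le> k" "\<gamma> = eps i + eps k" "i + m = Suc k"
      show ?thesis
      proof (cases m)
        \<comment> \<open>On the main diagonal, lowering the second index makes it the smaller one,
          so the indices are swapped and the root lies on diagonal 1.\<close>
        case 0
        then have "\<gamma> = eps k + eps (k + Suc 0)" using k by (simp add: add.commute)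
        moreover have "k \<le> f (Suc 0)" using lattice_pathsD(3)[OF f, of 0] im k 0 by simp
        ultimately show ?thesis using k by (simp only: eps_add_in_ideal_of_iff)
      next
        case (Suc m')
        then have "\<gamma> = eps i + eps (i + m')" using k by simp
        moreover have "i \<le> f m'" using lattice_pathsD(2)[OF f, of m'] im Suc by simp
        ultimately show ?thesis using im by (simp only: eps_add_in_ideal_of_iff)
      qed
    qed
  qed
  then have "upper_ideal_C n (ideal_of f)" using sub by (auto simp: upper_ideal_C_iff)
  moreover have "\<gamma> + \<gamma>' \<notin> pos_roots_C n" if "\<gamma> \<in> ideal_of f" "\<gamma>' \<in> ideal_of f" for \<gamma> \<gamma>'
  proof
    assume "\<gamma> + \<gamma>' \<in> pos_roots_C n"
    then have "(\<Sum>x\<le>n. (\<gamma> + \<gamma>') x) \<le> 2" by (rule sum_coords_pos_root)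
    moreover have "(\<Sum>x\<le>n. \<gamma> x) = 2" if \<gamma>: "\<gamma> \<in> ideal_of f" for \<gamma>
    proof -
      obtain i m where "\<gamma> = eps i + eps (i + m)" "1 \<le> i" "i \<le> f m"
        using \<gamma> by (auto simp: ideal_of_def)
      then show ?thesis using bound[of i m] by (simp add: sum.distrib sum_coords_eps)
    qed
    ultimately show False using that by (simp add: sum.distrib)
  qed
  ultimately show ?thesis by (auto simp: abelian_ideals_C_def abelian_C_def)
qed

section \<open>From abelian ideals to lattice paths\<close>

lemma upper_ideal_C_step:
  assumes "upper_ideal_C n I" "\<mu> \<in> I" "\<gamma> \<in> pos_roots_C n" "\<gamma> - \<mu> \<in> simple_roots_C n"
  shows "\<gamma> \<in> I"
  using assms unfolding upper_ideal_C_iff by (auto simp: root_cover_C_def)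

lemma eps_diff_notin_abelian_ideal:
  assumes I: "I \<in> abelian_ideals_C n" and ij: "1 \<le> i" "i < j" "j \<le> n"
  shows "eps i - eps j \<notin> I"
proof
  assume mem: "eps i - eps j \<in> I"
  have up: "upper_ideal_C n I" and ab: "abelian_C n I"
    using I by (auto simp: abelian_ideals_C_def)
  have "eps i - eps k \<in> I" if "j \<le> k" "k \<le> n" for k
    using that
  proof (induction k rule: dec_induct)
    case (step k)
    show ?case
    proof (rule upper_ideal_C_step[OF up])
      show "eps i - eps k \<in> I" by (rule step.IH) (use step in auto)
      show "eps i - eps (Suc k) \<in> pos_roots_C n"
        using ij step by (intro eps_diff_in_pos_roots_C) auto
      show "eps i - eps (Suc k) - (eps i - eps k) \<in> simple_roots_C n"
        using ij step by (auto simp: simple_roots_C_def intro!: exI[of _ k])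
    qed
  qed (simp add: mem)
  then have minus: "eps i - eps n \<in> I" using \<open>j \<le> n\<close> by simp
  have "eps i + eps n \<in> I"
  proof (rule upper_ideal_C_step[OF up minus])
    show "eps i + eps n \<in> pos_roots_C n" using ij by (intro eps_add_in_pos_roots_C) auto
    show "eps i + eps n - (eps i - eps n) \<in> simple_roots_C n"
      by (simp add: simple_roots_C_def)
  qed
  then have "(eps i - eps n) + (eps i + eps n) \<notin> pos_roots_C n"
    using ab minus unfolding abelian_C_def by blast
  moreover have "(eps i - eps n) + (eps i + eps n) = eps i + eps i" by simp
  ultimately show False using ij eps_add_in_pos_roots_C[of i i n] by simp
qed

lemma abelian_ideal_in_image_ideal_of:
  assumes I: "I \<in> abelian_ideals_C n"
  shows "I \<in> ideal_of ` lattice_paths n"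
proof -
  have up: "upper_ideal_C n I" using I by (auto simp: abelian_ideals_C_def)
  have sub: "I \<subseteq> pos_roots_C n" using up by (simp add: upper_ideal_C_def)
  have form: "\<exists>i m. v = eps i + eps (i + m) \<and> 1 \<le> i \<and> i + m \<le> n" if "v \<in> I" for v
  proof -
    have "v \<in> pos_roots_C n" using sub that by auto
    then show ?thesis
    proof (cases rule: pos_roots_C_cases)
      case (diff i j)
      then show ?thesis using eps_diff_notin_abelian_ideal[OF I] that by blast
    next
      case (sum i j)
      then show ?thesis by (intro exI[of _ i] exI[of _ "j - i"]) auto
    qed
  qed
  have bound: "1 \<le> i \<and> i + m \<le> n" if "eps i + eps (i + m) \<in> I" for i m
    using form[OF that] by (auto simp: eps_add_eps_eq_iff)
  \<comment> \<open>\<open>left\<close> and \<open>above\<close> each lower one index by one; they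
    become the two inequalities that define a path.\<close>
  have left: "eps i + eps (i + m) \<in> I" if "eps i + eps (i + Suc m) \<in> I" for i m
  proof (rule upper_ideal_C_step[OF up that])
    show "eps i + eps (i + m) \<in> pos_roots_C n"
      using bound[OF that] by (intro eps_add_in_pos_roots_C) auto
    show "eps i + eps (i + m) - (eps i + eps (i + Suc m)) \<in> simple_roots_C n"
      using bound[OF that] by (auto simp: simple_roots_C_def intro!: exI[of _ "i + m"])
  qed
  have above: "eps i + eps (i + Suc m) \<in> I" if "eps (Suc i) + eps (Suc i + m) \<in> I" "1 \<le> i" for i m
  proof (rule upper_ideal_C_step[OF up that(1)])
    show "eps i + eps (i + Suc m) \<in> pos_roots_C n"
      using bound[OF that(1)] that(2) by (intro eps_add_in_pos_roots_C) auto
    show "eps i + eps (i + Suc m) - (eps (Suc i) + eps (Suc i + m)) \<in> simple_roots_C n"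
      using bound[OF that(1)] that(2) by (auto simp: simple_roots_C_def intro!: exI[of _ i])
  qed
  define D where "D m = {i. eps i + eps (i + m) \<in> I}" for m
  define f where "f m = card (D m)" for m
  have D_sub: "D m \<subseteq> {1..n - m}" for m using bound by (fastforce simp: D_def)
  have D_eq: "D m = {1..f m}" for m
  proof -
    \<comment> \<open>From the indices \<open>Suc i, Suc i + m\<close>, \<open>above\<close> reaches
      \<open>i, i + Suc m\<close> and \<open>left\<close> then reaches \<open>i, i + m\<close>; so
      each diagonal is an initial segment.\<close>
    have dn: "i \<in> D m" if "Suc i \<in> D m" "1 \<le> i" for i
      using above left that by (simp add: D_def)
    have dn': "i \<in> D m" if "i \<le> k" "k \<in> D m" "1 \<le> i" for i k
      using that by (induction rule: inc_induct) (auto intro: dn)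
    have fin: "finite (D m)" using D_sub[of m] finite_subset by blast
    show ?thesis
    proof (cases "D m = {}")
      case False
      have "D m = {1..Max (D m)}"
      proof
        show "D m \<subseteq> {1..Max (D m)}" using fin D_sub[of m] by auto
        show "{1..Max (D m)} \<subseteq> D m" using dn' Max_in[OF fin False] by auto
      qed
      then show ?thesis by (metis f_def card_atLeastAtMost diff_Suc_1)
    qed (simp add: f_def)
  qed
  have mem: "eps i + eps (i + m) \<in> I \<longleftrightarrow> 1 \<le> i \<and> i \<le> f m" for i m
    using D_eq[of m] unfolding D_def set_eq_iff by simp
  have "f \<in> lattice_paths n"
  proof -
    have "f m = 0" if "m \<ge> n" for m using D_sub[of m] that by (simp add: f_def)
    moreover have "f (Suc m) \<le> f m" for m
    proof (cases "f (Suc m) = 0")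
      case False
      then show ?thesis using left[of "f (Suc m)" m] by (simp only: mem) simp
    qed simp
    moreover have "f m \<le> Suc (f (Suc m))" for m
    \<comment> \<open>\<open>above\<close> is applied with \<open>i = f m - 1\<close>, which must be
      at least 1.\<close>
    proof (cases "f m \<le> 1")
      case False
      then have "eps (Suc (f m - 1)) + eps (Suc (f m - 1) + m) \<in> I" by (simp only: mem) simp
      from above[OF this] have "f m - 1 \<le> f (Suc m)" using False by (simp only: mem)
      then show ?thesis by simp
    qed simp
    ultimately show ?thesis by (simp add: lattice_paths_def)
  qed
  moreover have "I = ideal_of f"
  proof
    show "I \<subseteq> ideal_of f"
    proof
      fix v assume "v \<in> I"
      then obtain i m where "v = eps i + eps (i + m)" using form by blast
      then show "v \<in> ideal_of f" using \<open>v \<in> I\<close> by (simp only: mem eps_add_in_ideal_of_iff)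
    qed
    show "ideal_of f \<subseteq> I"
      unfolding ideal_of_def using mem by blast
  qed
  ultimately show ?thesis by blast
qed

lemma bij_betw_ideal_of: "bij_betw ideal_of (lattice_paths n) (abelian_ideals_C n)"
  unfolding bij_betw_def
proof
  show "inj_on ideal_of (lattice_paths n)"
    by (rule inj_onI) (metis ideal_of_le_iff order.antisym order.refl)
  show "ideal_of ` lattice_paths n = abelian_ideals_C n"
    using ideal_of_in_abelian_ideals_C abelian_ideal_in_image_ideal_of by blast
qed

theorem theorem5p2:
  fixes n :: nat
  assumes "n \<ge> 1"
  shows "K_upper (abelian_ideals_C n) = K_lower (abelian_ideals_C n) \<and>
         K_lower (abelian_ideals_C n) =
           (\<Sum>k\<le>n+1. monom (int ((n + 1) choose (2 * k))) k)"
  by (simp only: K_upper_iso[OF bij_betw_ideal_of ideal_of_le_iff]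
      K_lower_iso[OF bij_betw_ideal_of ideal_of_le_iff]
      K_upper_lattice_paths K_lower_lattice_paths run_poly_eq)

end
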